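(* In the setting described in the context (a steady gradient Ricci soliton $\mathrm{Ric}(g)+\mathrm{Hess}(u)=0$ with $g=dt^2+g_t$ and $u=u(t)$), the function $$t\longmapsto(\dot u-\mathrm{tr}\,L)^{-2}$$ is a Lyapunov function, that is, it is monotonic on each interval on which it is defined.
   Context: $M$ is a manifold with an open dense set foliated by diffeomorphic hypersurfaces $P_t$ of real dimension $n$, on which the metric has the form $g=dt^2+g_t$, with $g_t$ a metric on $P_t$ and $t$ the arclength along a geodesic orthogonal to the hypersurfaces. A dot denotes $d/dt$. $L=L_t$ is the shape operator of $P_t$, i.e. $\dot g_t=2g_tL_t$, and $r_t$ is the Ricci tensor of $g_t$ viewed as an endomorphism via $g_t$. It is assumed that the scalar curvature $\mathrm{tr}(r_t)$ and the mean curvature $\mathrm{tr}(L_t)$ are constant on each hypersurface and that the codifferential $\delta^{\nabla^t}L_t$ vanishes, where $L_t$ is viewed as a $TP_t$-valued $1$-form on $P_t$. The function $u$ depends on $t$ only. Under these assumptions the steady gradient soliton equation $\mathrm{Ric}(g)+\mathrm{Hess}(u)=0$ is the system $$-\mathrm{tr}(\dot L)-\mathrm{tr}(L^2)+\ddot u=0,\qquad r_t-(\mathrm{tr}\,L)L-\dot L+\dot uL=0.$$ The function in the claim is defined where $\dot u\ne\mathrm{tr}\,L$. *)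

theory Defs
  imports "HOL-Analysis.Analysis"
begin

section \<open>Smooth maps between open subsets of Euclidean spaces\<close>

text \<open>Meant for open \<open>S\<close> only: all derivatives below are unrestricted Frechet derivatives.\<close>

primrec Ck_on :: "nat \<Rightarrow> 'a::euclidean_space set \<Rightarrow> ('a \<Rightarrow> 'b::real_normed_vector) \<Rightarrow> bool" where
  "Ck_on 0 S f \<longleftrightarrow> continuous_on S f"
| "Ck_on (Suc k) S f \<longleftrightarrow>
     (\<forall>x\<in>S. f differentiable (at x)) \<and> (\<forall>v. Ck_on k S (\<lambda>x. frechet_derivative f (at x) v))"

definition smooth_on :: "'a::euclidean_space set \<Rightarrow> ('a \<Rightarrow> 'b::real_normed_vector) \<Rightarrow> bool" where
  "smooth_on S f \<longleftrightarrow> (\<forall>k. Ck_on k S f)"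

section \<open>Smooth manifolds\<close>

text \<open>A chart is a domain together with a map, of which only the values on the domain matter.
  An n-dimensional manifold is a Hausdorff, second countable type with a maximal smooth atlas of
  charts into some Euclidean space of dimension n.\<close>

type_synonym ('m, 'e) chart = "'m set \<times> ('m \<Rightarrow> 'e)"

abbreviation chart_image :: "('m, 'e) chart \<Rightarrow> 'e set" where
  "chart_image c \<equiv> snd c ` fst c"

abbreviation chart_inv :: "('m, 'e) chart \<Rightarrow> 'e \<Rightarrow> 'm" where
  "chart_inv c \<equiv> inv_into (fst c) (snd c)"

definition is_chart :: "('m::topological_space, 'e::euclidean_space) chart \<Rightarrow> bool" where
  "is_chart c \<longleftrightarrow> open (fst c) \<and> open (chart_image c) \<and> inj_on (snd c) (fst c) \<and>
     homeomorphism (fst c) (chart_image c) (snd c) (chart_inv c)"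

definition transition :: "('m, 'e) chart \<Rightarrow> ('m, 'e) chart \<Rightarrow> 'e \<Rightarrow> 'e" where
  "transition c d = snd d \<circ> chart_inv c"

definition compatible ::
    "('m::topological_space, 'e::euclidean_space) chart \<Rightarrow> ('m, 'e) chart \<Rightarrow> bool" where
  "compatible c d \<longleftrightarrow>
     smooth_on (snd c ` (fst c \<inter> fst d)) (transition c d) \<and>
     smooth_on (snd d ` (fst c \<inter> fst d)) (transition d c)"

definition smooth_structure ::
    "('m::{t2_space,second_countable_topology}, 'e::euclidean_space) chart set \<Rightarrow> bool" where
  "smooth_structure A \<longleftrightarrow>
     (\<forall>c\<in>A. is_chart c) \<and> (\<Union>c\<in>A. fst c) = UNIV \<and> (\<forall>c\<in>A. \<forall>d\<in>A. compatible c d) \<and>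
     (\<forall>c. is_chart c \<and> (\<forall>d\<in>A. compatible c d) \<longrightarrow> c \<in> A)"

definition smooth_fun :: "('m, 'e::euclidean_space) chart set \<Rightarrow> ('m \<Rightarrow> real) \<Rightarrow> bool" where
  "smooth_fun A f \<longleftrightarrow> (\<forall>c\<in>A. smooth_on (chart_image c) (f \<circ> chart_inv c))"

definition local_rep ::
    "('m, 'e) chart \<Rightarrow> ('n, 'f) chart \<Rightarrow> ('m \<Rightarrow> 'n) \<Rightarrow> 'e \<Rightarrow> 'f" where
  "local_rep c d F = snd d \<circ> F \<circ> chart_inv c"

text \<open>Here \<open>S\<close> is an open subset of the source, and \<open>A\<close>, \<open>B\<close> are atlases that cover \<open>S\<close> and
  the image \<open>F ` S\<close>; they need not be maximal.\<close>

definition smooth_map :: "('m::topological_space, 'e::euclidean_space) chart set \<Rightarrow> 'm set \<Rightarrow>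
    ('n::topological_space, 'f::euclidean_space) chart set \<Rightarrow> ('m \<Rightarrow> 'n) \<Rightarrow> bool" where
  "smooth_map A S B F \<longleftrightarrow> continuous_on S F \<and>
     (\<forall>c\<in>A. \<forall>d\<in>B. smooth_on (snd c ` (fst c \<inter> S \<inter> F -` fst d)) (local_rep c d F))"

definition diffeomorphism :: "('m::topological_space, 'e::euclidean_space) chart set \<Rightarrow> 'm set \<Rightarrow>
    ('n::topological_space, 'f::euclidean_space) chart set \<Rightarrow> 'n set \<Rightarrow> ('m \<Rightarrow> 'n) \<Rightarrow> bool" where
  "diffeomorphism A S B T F \<longleftrightarrow>
     bij_betw F S T \<and> smooth_map A S B F \<and> smooth_map B T A (inv_into S F)"

section \<open>Riemannian metrics\<close>

text \<open>A metric is given by its expression \<open>g c x\<close> in every chart \<open>c\<close>, at coordinates \<open>x\<close>; the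
  expressions are related by the transformation law of a covariant 2-tensor field.\<close>

type_synonym 'e local_metric = "'e \<Rightarrow> 'e \<Rightarrow> 'e \<Rightarrow> real"

definition riemannian_metric :: "('m, 'e::euclidean_space) chart set \<Rightarrow>
    (('m, 'e) chart \<Rightarrow> 'e local_metric) \<Rightarrow> bool" where
  "riemannian_metric A g \<longleftrightarrow>
     (\<forall>c\<in>A. (\<forall>v w. smooth_on (chart_image c) (\<lambda>x. g c x v w)) \<and>
        (\<forall>x\<in>chart_image c. bilinear (g c x) \<and> (\<forall>v w. g c x v w = g c x w v) \<and>
           (\<forall>v. v \<noteq> 0 \<longrightarrow> g c x v v > 0))) \<and>
     (\<forall>c\<in>A. \<forall>d\<in>A. \<forall>x\<in>snd c ` (fst c \<inter> fst d). \<forall>v w.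
        g c x v w = g d (transition c d x)
          (frechet_derivative (transition c d) (at x) v)
          (frechet_derivative (transition c d) (at x) w))"

section \<open>Curvature in a coordinate domain\<close>

definition endo_trace :: "('e::euclidean_space \<Rightarrow> 'e) \<Rightarrow> real" where
  "endo_trace T = (\<Sum>b\<in>Basis. T b \<bullet> b)"

text \<open>The vector metrically dual to a covector, for an inner product \<open>G\<close>.\<close>

definition sharp :: "('e \<Rightarrow> 'e \<Rightarrow> real) \<Rightarrow> ('e \<Rightarrow> real) \<Rightarrow> 'e" where
  "sharp G \<alpha> = (THE z. \<forall>y. G z y = \<alpha> y)"

text \<open>\<open>christoffel G x v w\<close> is the covariant derivative at \<open>x\<close>, along \<open>v\<close>, of the vector field with
  constant coordinates \<open>w\<close>, i.e. the vector with components
  \<open>\<Gamma>\<^sup>k\<^sub>i\<^sub>j v\<^sup>i w\<^sup>j\<close> (Koszul formula; brackets of constant fields vanish).\<close>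

definition christoffel :: "'e::euclidean_space local_metric \<Rightarrow> 'e \<Rightarrow> 'e \<Rightarrow> 'e \<Rightarrow> 'e" where
  "christoffel G x v w = sharp (G x) (\<lambda>y.
     (frechet_derivative (\<lambda>z. G z w y) (at x) v +
      frechet_derivative (\<lambda>z. G z v y) (at x) w -
      frechet_derivative (\<lambda>z. G z v w) (at x) y) / 2)"

text \<open>\<open>riemann G x z v w\<close> is \<open>R(z, v) w\<close> with \<open>R(z, v) = [\<nabla>\<^sub>z, \<nabla>\<^sub>v] - \<nabla>\<^bsub>[z, v]\<^esub>\<close>.\<close>

definition riemann :: "'e::euclidean_space local_metric \<Rightarrow> 'e \<Rightarrow> 'e \<Rightarrow> 'e \<Rightarrow> 'e \<Rightarrow> 'e" where
  "riemann G x z v w =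
     frechet_derivative (\<lambda>y. christoffel G y v w) (at x) z -
     frechet_derivative (\<lambda>y. christoffel G y z w) (at x) v +
     christoffel G x z (christoffel G x v w) -
     christoffel G x v (christoffel G x z w)"

definition ricci :: "'e::euclidean_space local_metric \<Rightarrow> 'e local_metric" where
  "ricci G x v w = endo_trace (\<lambda>z. riemann G x z v w)"

definition ricci_endo :: "'e::euclidean_space local_metric \<Rightarrow> 'e \<Rightarrow> 'e \<Rightarrow> 'e" where
  "ricci_endo G x v = sharp (G x) (ricci G x v)"

definition hessian :: "'e::euclidean_space local_metric \<Rightarrow> ('e \<Rightarrow> real) \<Rightarrow> 'e local_metric" where
  "hessian G f x v w =
     frechet_derivative (\<lambda>y. frechet_derivative f (at y) w) (at x) v -
     frechet_derivative f (at x) (christoffel G x v w)"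

text \<open>Covariant derivative of an endomorphism field \<open>T\<close>, and the codifferential of \<open>T\<close> regarded as
  a 1-form with values in the tangent bundle, \<open>- g\<^sup>i\<^sup>j (\<nabla>\<^sub>i T) e\<^sub>j\<close>; as \<open>b\<close>
  runs through the basis, the vectors \<open>sharp (G x) (\<lambda>y. y \<bullet> b)\<close> are those dual to it with respect to
  the metric.\<close>

definition cov_deriv_endo ::
    "'e::euclidean_space local_metric \<Rightarrow> ('e \<Rightarrow> 'e \<Rightarrow> 'e) \<Rightarrow> 'e \<Rightarrow> 'e \<Rightarrow> 'e \<Rightarrow> 'e" where
  "cov_deriv_endo G T x v w =
     frechet_derivative (\<lambda>y. T y w) (at x) v +
     christoffel G x v (T x w) - T x (christoffel G x v w)"

definition codifferential ::
    "'e::euclidean_space local_metric \<Rightarrow> ('e \<Rightarrow> 'e \<Rightarrow> 'e) \<Rightarrow> 'e \<Rightarrow> 'e" where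
  "codifferential G T x = - (\<Sum>b\<in>Basis. cov_deriv_endo G T x b (sharp (G x) (\<lambda>y. y \<bullet> b)))"

text \<open>The endomorphism \<open>L\<close> with \<open>dG/dt = 2 G(L _, _)\<close>, for a one-parameter family of metrics.\<close>

definition shape_op ::
    "(real \<Rightarrow> 'e::euclidean_space local_metric) \<Rightarrow> real \<Rightarrow> 'e \<Rightarrow> 'e \<Rightarrow> 'e" where
  "shape_op G t x v = sharp (G t x) (\<lambda>w. deriv (\<lambda>s. G s x v w) t / 2)"

section \<open>Gradient Ricci solitons and families of equidistant hypersurfaces\<close>

definition steady_gradient_soliton :: "('m, 'e::euclidean_space) chart set \<Rightarrow>
    (('m, 'e) chart \<Rightarrow> 'e local_metric) \<Rightarrow> ('m \<Rightarrow> real) \<Rightarrow> bool" where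
  "steady_gradient_soliton A g u \<longleftrightarrow> smooth_fun A u \<and>
     (\<forall>c\<in>A. \<forall>x\<in>chart_image c. \<forall>v w.
        ricci (g c) x v w + hessian (g c) (u \<circ> chart_inv c) x v w = 0)"

definition product_chart :: "real set \<Rightarrow> ('p, 'e) chart \<Rightarrow> (real \<times> 'p, real \<times> 'e) chart" where
  "product_chart I c = (I \<times> fst c, \<lambda>(t, p). (t, snd c p))"

text \<open>\<open>\<Phi>\<close> identifies \<open>I \<times> P\<close> with an open dense subset of \<open>M\<close>, and the pullback of \<open>g\<close> is
  \<open>dt\<^sup>2 + h t\<close>. The hypersurface \<open>P\<^sub>t\<close> is \<open>\<Phi> ` ({t} \<times> P)\<close>, and the curves \<open>t \<mapsto> \<Phi> (t, p)\<close> are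
  the unit speed geodesics orthogonal to these hypersurfaces.\<close>

definition equidistant_foliation ::
    "('m::topological_space, real \<times> 'e::euclidean_space) chart set \<Rightarrow>
     (('m, real \<times> 'e) chart \<Rightarrow> (real \<times> 'e) local_metric) \<Rightarrow>
     ('p::topological_space, 'e) chart set \<Rightarrow> real set \<Rightarrow> (real \<times> 'p \<Rightarrow> 'm) \<Rightarrow>
     (real \<Rightarrow> ('p, 'e) chart \<Rightarrow> 'e local_metric) \<Rightarrow> bool" where
  "equidistant_foliation A g B I \<Phi> h \<longleftrightarrow>
     open I \<and> is_interval I \<and> I \<noteq> {} \<and>
     (\<forall>t\<in>I. riemannian_metric B (h t)) \<and>
     (\<exists>U. open U \<and> closure U = UNIV \<and>
        diffeomorphism (product_chart I ` B) (I \<times> UNIV) A U \<Phi>) \<and>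
     (\<forall>c\<in>B. \<forall>d\<in>A. \<forall>t\<in>I. \<forall>p\<in>fst c. \<Phi> (t, p) \<in> fst d \<longrightarrow>
        (let F = local_rep (product_chart I c) d \<Phi>; x = snd c p;
             DF = frechet_derivative F (at (t, x))
         in \<forall>v w. g d (F (t, x)) (DF v) (DF w) =
              fst v * fst w + h t c x (snd v) (snd w)))"

end

theory Submission
  imports Defs
begin

text \<open>Only the component of the soliton equation in the direction of \<open>dt\<close> matters. Since the atlas
  is maximal, the product of the interval with a chart of the hypersurface gives a chart of the
  manifold, in which the metric is \<open>dt\<^sup>2 + h\<^sub>t\<close>. There the equation
  reads \<open>f'' - H' = tr (L\<^sup>2)\<close>, and \<open>tr (L\<^sup>2) \<ge> 0\<close> because \<open>L\<close> is
  self-adjoint. So \<open>f' - H\<close> is nondecreasing, and on an interval where it does not vanish it has a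
  constant sign.\<close>

section \<open>Inner products on a Euclidean space\<close>

text \<open>The obstacle is regularity. \<open>shape_op\<close> takes a pointwise
  \<open>deriv\<close> of \<open>h\<close> in t and then \<open>sharp\<close>, a definite
  description, while \<open>equidistant_foliation\<close> only says that each \<open>h t\<close> is
  a smooth metric on its own hypersurface. Joint smoothness in t and x comes from \<open>g\<close>:
  in the product chart \<open>h\<close> consists of components of \<open>g\<close>, which are smooth
  on an open set. To pass through \<open>sharp\<close>, the metric dual must depend differentiably
  on the metric and on the covector; this is derived from its defining equation, without inverse
  matrices, and is the purpose of the estimates of this section. Since \<open>f\<close> and
  \<open>H\<close> depend on t alone, the equation can be read off along the curve over a single
  point of a single chart. With N the coordinate field \<open>(1, 0)\<close>, one has R(z, N) N =
  -(L' + L^2) z, whose trace is -tr L' - tr (L^2). No derivative of \<open>L\<close> along the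
  hypersurface occurs, because the covariant derivative of N along N is zero.\<close>

definition inner_form :: "('e::euclidean_space \<Rightarrow> 'e \<Rightarrow> real) \<Rightarrow> bool" where
  "inner_form G \<longleftrightarrow> bilinear G \<and> (\<forall>v w. G v w = G w v) \<and> (\<forall>v. v \<noteq> 0 \<longrightarrow> G v v > 0)"

lemma inner_form_linear:
  assumes "inner_form G"
  shows "linear (G v)" "linear (\<lambda>w. G w v)"
  using assms by (auto simp: inner_form_def bilinear_def)

lemma inner_form_sym: "inner_form G \<Longrightarrow> G v w = G w v"
  by (simp add: inner_form_def)

lemma inner_form_eq_0:
  assumes "inner_form G" "\<And>y. G z y = 0"
  shows "z = 0"
  using assms by (metis inner_form_def less_irrefl)

lemma inner_form_zero:
  assumes "inner_form G"
  shows "G 0 v = 0" "G v 0 = 0"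
  using inner_form_linear[OF assms] by (auto dest: linear_0)

definition orthonormal_frame :: "('e::euclidean_space \<Rightarrow> 'e \<Rightarrow> real) \<Rightarrow> 'e set \<Rightarrow> bool" where
  "orthonormal_frame G F \<longleftrightarrow> finite F \<and>
     (\<forall>e\<in>F. \<forall>e'\<in>F. G e e' = (if e = e' then 1 else 0)) \<and> (\<forall>v. v = (\<Sum>e\<in>F. G v e *\<^sub>R e))"

text \<open>Gram-Schmidt, one vector at a time: the projection of \<open>b\<close> onto the span of
  \<open>F\<close> is subtracted, and the normalised residual is adjoined unless it is zero. Asking
  for the expansion on a finite set only makes this an induction, and no dimension has to be
  counted.\<close>

lemma orthonormal_expansion_exists:
  assumes G: "inner_form G" and "finite B"
  shows "\<exists>F. finite F \<and> (\<forall>e\<in>F. \<forall>e'\<in>F. G e e' = (if e = e' then 1 else 0)) \<and>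
    (\<forall>v\<in>B. v = (\<Sum>e\<in>F. G v e *\<^sub>R e))"
  using \<open>finite B\<close>
proof induction
  case empty
  then show ?case by (intro exI[of _ "{}"]) auto
next
  case (insert b B)
  then obtain F where F: "finite F" "\<And>e e'. e \<in> F \<Longrightarrow> e' \<in> F \<Longrightarrow> G e e' = (if e = e' then 1 else 0)"
    "\<And>v. v \<in> B \<Longrightarrow> v = (\<Sum>e\<in>F. G v e *\<^sub>R e)"
    by metis
  note lin = inner_form_linear[OF G]
  define r where "r = b - (\<Sum>e\<in>F. G b e *\<^sub>R e)"
  have r_orth: "G r e = 0" if "e \<in> F" for e
  proof -
    have "G r e = G b e - (\<Sum>e'\<in>F. G b e' * G e' e)"
      by (simp add: r_def linear_diff[OF lin(2)] linear_sum[OF lin(2)] linear_cmul[OF lin(2)])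
    also have "(\<Sum>e'\<in>F. G b e' * G e' e) = (\<Sum>e'\<in>F. if e' = e then G b e' else 0)"
      using that by (intro sum.cong) (auto simp: F(2))
    also have "\<dots> = G b e"
      using F(1) that by simp
    finally show ?thesis by simp
  qed
  show ?case
  proof (cases "r = 0")
    case True
    then show ?thesis
      using F by (intro exI[of _ F]) (auto simp: r_def)
  next
    case False
    define n where "n = (1 / sqrt (G r r)) *\<^sub>R r"
    have pos: "G r r > 0"
      using False G by (auto simp: inner_form_def)
    have n_orth: "G n e = 0" "G e n = 0" if "e \<in> F" for e
      using r_orth[OF that] inner_form_sym[OF G, of e n]
      by (auto simp: n_def linear_cmul[OF lin(2)])
    have nn: "G n n = 1"
      using pos by (simp add: n_def linear_cmul[OF lin(2)] linear_cmul[OF lin(1)] field_simps)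
    have "n \<notin> F"
      using n_orth nn by force
    \<comment> \<open>The residual \<open>r\<close> is orthogonal to \<open>b - r\<close>, which
      lies in the span of \<open>F\<close>. So the coefficient of \<open>b\<close> along
      \<open>n\<close> is sqrt (G r r), and the new term of the expansion is exactly
      \<open>r\<close>.\<close>
    have "G r b = G r r"
    proof -
      have "G r b = G r (r + (\<Sum>e\<in>F. G b e *\<^sub>R e))"
        by (simp add: r_def)
      also have "\<dots> = G r r"
        by (simp add: linear_add[OF lin(1)] linear_sum[OF lin(1)] linear_cmul[OF lin(1)] r_orth)
      finally show ?thesis .
    qed
    then have "G b n *\<^sub>R n = r"
      using pos by (simp add: inner_form_sym[OF G, of b] n_def linear_cmul[OF lin(2)])
    moreover have "G v n = 0" if "v \<in> B" for v
    proof -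
      have "G v n = G (\<Sum>e\<in>F. G v e *\<^sub>R e) n"
        using F(3)[OF that] by simp
      also have "\<dots> = 0"
        by (simp add: linear_sum[OF lin(2)] linear_cmul[OF lin(2)] n_orth)
      finally show ?thesis .
    qed
    ultimately have "v = (\<Sum>e\<in>insert n F. G v e *\<^sub>R e)" if "v \<in> insert b B" for v
      using that F(1) F(3)[of v] \<open>n \<notin> F\<close> by (auto simp: r_def)
    moreover have "G e e' = (if e = e' then 1 else 0)" if "e \<in> insert n F" "e' \<in> insert n F" for e e'
      using that n_orth nn F(2) \<open>n \<notin> F\<close> by auto
    ultimately show ?thesis
      using F(1) by (intro exI[of _ "insert n F"]) blast
  qed
qed

text \<open>Both sides of the expansion are linear in \<open>v\<close>, so the finite set
  \<open>Basis\<close> suffices.\<close>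

lemma orthonormal_frame_exists:
  assumes G: "inner_form G"
  obtains F where "orthonormal_frame G F"
proof -
  obtain F where F: "finite F" "\<And>e e'. e \<in> F \<Longrightarrow> e' \<in> F \<Longrightarrow> G e e' = (if e = e' then 1 else 0)"
    "\<And>v. v \<in> Basis \<Longrightarrow> v = (\<Sum>e\<in>F. G v e *\<^sub>R e)"
    using orthonormal_expansion_exists[OF G finite_Basis] by metis
  have lin: "linear (\<lambda>v. \<Sum>e\<in>F. G v e *\<^sub>R e)"
    using inner_form_linear(2)[OF G]
    by (intro linear_compose_sum ballI)
      (auto simp: linear_iff scaleR_add_left)
  have "v = (\<Sum>e\<in>F. G v e *\<^sub>R e)" for v
    using linear_eq_stdbasis[OF linear_ident lin F(3)] by metis
  then show thesis
    using that F by (auto simp: orthonormal_frame_def)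
qed

text \<open>Nondegeneracy makes the described vector unique. Every \<open>sharp\<close> below, and
  so every Christoffel symbol, is computed by exhibiting the answer and testing it against all
  vectors.\<close>

lemma sharp_eqI:
  assumes G: "inner_form G" and z: "\<And>y. G z y = \<alpha> y"
  shows "sharp G \<alpha> = z"
  unfolding sharp_def
proof (rule the_equality)
  show "\<forall>y. G z y = \<alpha> y" using z by simp
next
  fix z' assume z': "\<forall>y. G z' y = \<alpha> y"
  have "G (z' - z) y = 0" for y
    using z z' by (simp add: linear_diff[OF inner_form_linear(2)[OF G]])
  then show "z' = z"
    using inner_form_eq_0[OF G] by fastforce
qed

text \<open>Riesz representation: the dual vector is the sum of
  \<open>\<alpha> e *\<^sub>R e\<close> over an orthonormal frame.\<close>

lemma sharp_works:
  assumes G: "inner_form G" and \<alpha>: "linear \<alpha>"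
  shows "G (sharp G \<alpha>) y = \<alpha> y"
proof -
  obtain F where F: "orthonormal_frame G F"
    using orthonormal_frame_exists[OF G] .
  note lin = inner_form_linear[OF G]
  define z where "z = (\<Sum>e\<in>F. \<alpha> e *\<^sub>R e)"
  have "G z y = \<alpha> y" for y
  proof -
    have "\<alpha> y = \<alpha> (\<Sum>e\<in>F. G y e *\<^sub>R e)"
      using F by (metis orthonormal_frame_def)
    also have "\<dots> = G z y"
      by (simp add: z_def linear_sum[OF \<alpha>] linear_sum[OF lin(2)] linear_cmul[OF \<alpha>]
          linear_cmul[OF lin(2)] inner_form_sym[OF G, of y] mult.commute)
    finally show ?thesis by simp
  qed
  then show ?thesis
    using sharp_eqI[OF G] by metis
qed

lemma sharp_linear:
  assumes G: "inner_form G" and \<alpha>: "\<And>v. linear (\<alpha> v)" "\<And>w. linear (\<lambda>v. \<alpha> v w)"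
  shows "linear (\<lambda>v. sharp G (\<alpha> v))"
proof (rule linearI)
  fix v v' and r :: real
  note lin = inner_form_linear[OF G]
  show "sharp G (\<alpha> (v + v')) = sharp G (\<alpha> v) + sharp G (\<alpha> v')"
    by (rule sharp_eqI[OF G])
      (simp add: linear_add[OF lin(2)] sharp_works[OF G \<alpha>(1)] linear_add[OF \<alpha>(2)])
  show "sharp G (\<alpha> (r *\<^sub>R v)) = r *\<^sub>R sharp G (\<alpha> v)"
    by (rule sharp_eqI[OF G])
      (simp add: linear_cmul[OF lin(2)] sharp_works[OF G \<alpha>(1)] linear_cmul[OF \<alpha>(2)])
qed

text \<open>\<open>endo_trace\<close> uses the Euclidean inner product, which is unrelated to
  \<open>G\<close>. Expanding the standard basis in the frame and exchanging the two sums passes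
  from one to the other.\<close>

lemma endo_trace_orthonormal_frame:
  assumes F: "orthonormal_frame G F" and T: "linear T" and G: "inner_form G"
  shows "endo_trace T = (\<Sum>e\<in>F. G (T e) e)"
proof -
  note lin = inner_form_linear[OF G]
  have "endo_trace T = (\<Sum>b\<in>Basis. T (\<Sum>e\<in>F. G b e *\<^sub>R e) \<bullet> b)"
    using F unfolding endo_trace_def orthonormal_frame_def by metis
  also have "\<dots> = (\<Sum>b\<in>Basis. \<Sum>e\<in>F. G b e * (T e \<bullet> b))"
    by (simp add: linear_sum[OF T] linear_cmul[OF T] inner_sum_left)
  also have "\<dots> = (\<Sum>e\<in>F. \<Sum>b\<in>Basis. G b e * (T e \<bullet> b))"
    by (rule sum.swap)
  also have "\<dots> = (\<Sum>e\<in>F. G (\<Sum>b\<in>Basis. (T e \<bullet> b) *\<^sub>R b) e)"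
    by (simp add: linear_sum[OF lin(2)] linear_cmul[OF lin(2)] mult.commute)
  finally show ?thesis
    by (simp add: euclidean_representation)
qed

text \<open>By self-adjointness the diagonal entries of the square in a \<open>G\<close>-orthonormal
  frame are G (T e) (T e).\<close>

lemma endo_trace_square_nonneg:
  assumes G: "inner_form G" and T: "linear T" and self: "\<And>v w. G (T v) w = G v (T w)"
  shows "endo_trace (\<lambda>v. T (T v)) \<ge> 0"
proof -
  obtain F where F: "orthonormal_frame G F"
    using orthonormal_frame_exists[OF G] .
  have "linear (\<lambda>v. T (T v))"
    using linear_compose[OF T T] by (simp add: o_def)
  then have "endo_trace (\<lambda>v. T (T v)) = (\<Sum>e\<in>F. G (T e) (T e))"
    by (simp add: endo_trace_orthonormal_frame[OF F _ G] self)
  also have "\<dots> \<ge> 0"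
    using G by (intro sum_nonneg) (metis inner_form_def inner_form_zero(1)[OF G] less_eq_real_def)
  finally show ?thesis .
qed

section \<open>Differentiable dependence of the metric dual on a parameter\<close>

lemma differentiable_mult_vanishing:
  fixes p q :: "'a::real_normed_vector \<Rightarrow> real"
  assumes q: "q differentiable (at y0)" "q y0 = 0" and p: "isCont p y0"
  shows "(\<lambda>y. q y * p y) differentiable (at y0)"
proof -
  obtain D where D: "(q has_derivative D) (at y0)"
    using q(1) by (auto simp: differentiable_def)
  then have bl: "bounded_linear D" and
    lim: "((\<lambda>y. norm (q y - D (y - y0)) / norm (y - y0)) \<longlongrightarrow> 0) (at y0)"
    by (auto simp: has_derivative_iff_norm q(2))
  obtain K where K: "\<And>h. norm (D h) \<le> norm h * K"
    using bl bounded_linear.bounded by blast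
  have p_lim: "(p \<longlongrightarrow> p y0) (at y0)"
    using p by (simp add: isCont_def)
  have "((\<lambda>y. norm (q y - D (y - y0)) / norm (y - y0) * norm (p y) + \<bar>K\<bar> * norm (p y - p y0)) \<longlongrightarrow>
      0 * norm (p y0) + \<bar>K\<bar> * norm (p y0 - p y0)) (at y0)"
    by (intro tendsto_intros lim p_lim)
  then have bound_lim: "((\<lambda>y. norm (q y - D (y - y0)) / norm (y - y0) * norm (p y) +
      \<bar>K\<bar> * norm (p y - p y0)) \<longlongrightarrow> 0) (at y0)"
    by simp
  \<comment> \<open>The candidate derivative is h \<mapsto> D h * p y0. Its error is (q y - D (y -
    y0)) * p y, small by differentiability of \<open>q\<close>, plus D (y - y0) * (p y - p y0),
    small by continuity of \<open>p\<close>. Since \<open>K\<close> might be negative, its absolute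
    value is used.\<close>
  have bound: "norm (q y * p y - q y0 * p y0 - D (y - y0) * p y0) / norm (y - y0) \<le>
     norm (q y - D (y - y0)) / norm (y - y0) * norm (p y) + \<bar>K\<bar> * norm (p y - p y0)"
    if "y \<noteq> y0" for y
  proof -
    have "norm (q y * p y - q y0 * p y0 - D (y - y0) * p y0) =
        norm ((q y - D (y - y0)) * p y + D (y - y0) * (p y - p y0))"
      by (simp add: q(2) algebra_simps)
    also have "\<dots> \<le> norm (q y - D (y - y0)) * norm (p y) + norm (D (y - y0)) * norm (p y - p y0)"
      by (metis norm_mult norm_triangle_ineq)
    also have "\<dots> \<le> norm (q y - D (y - y0)) * norm (p y) +
        (norm (y - y0) * \<bar>K\<bar>) * norm (p y - p y0)"
      using K[of "y - y0"] mult_left_mono[OF abs_ge_self norm_ge_zero, of "y - y0" K]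
      by (intro add_left_mono mult_right_mono) (auto intro: order_trans)
    finally show ?thesis
      using that by (simp add: divide_simps) (simp add: algebra_simps)
  qed
  have "((\<lambda>y. q y * p y) has_derivative (\<lambda>h. D h * p y0)) (at y0)"
    unfolding has_derivative_iff_norm
  proof
    show "bounded_linear (\<lambda>h. D h * p y0)"
      using bl by (rule bounded_linear_mult_const)
    show "((\<lambda>y. norm (q y * p y - q y0 * p y0 - D (y - y0) * p y0) / norm (y - y0)) \<longlongrightarrow> 0) (at y0)"
      by (rule tendsto_sandwich[OF _ _ tendsto_const bound_lim])
        (use bound in \<open>auto simp: eventually_at intro!: exI[of _ 1]\<close>)
  qed
  then show ?thesis
    by (auto simp: differentiable_def)
qed

text \<open>No bound on \<open>z\<close> is known in advance. Measured in a frame orthonormal for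
  \<open>G y0\<close>, the size C of \<open>z y - z y0\<close> satisfies C \<le> \<rho> + C *
  \<delta>, where \<rho> is the error of the constant \<open>z y0\<close> in the equation at
  \<open>y\<close> and \<delta> is the change of the metric. Both tend to 0, so the last term is
  absorbed on the left.\<close>

lemma isCont_solution:
  fixes G :: "'a::real_normed_vector \<Rightarrow> 'e::euclidean_space \<Rightarrow> 'e \<Rightarrow> real"
  assumes ev: "eventually (\<lambda>y. inner_form (G y) \<and> (\<forall>w. G y (z y) w = \<alpha> y w)) (nhds y0)"
    and G: "\<And>v w. isCont (\<lambda>y. G y v w) y0"
    and \<alpha>: "\<And>w. isCont (\<lambda>y. \<alpha> y w) y0"
  shows "isCont z y0"
proof -
  have ev': "eventually (\<lambda>y. inner_form (G y) \<and> (\<forall>w. G y (z y) w = \<alpha> y w)) (at y0)"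
    using ev by (simp add: eventually_nhds_conv_at)
  have G0: "inner_form (G y0)" and z0: "\<And>w. G y0 (z y0) w = \<alpha> y0 w"
    using eventually_nhds_x_imp_x[OF ev] by auto
  note lin0 = inner_form_linear[OF G0]
  obtain F where F: "orthonormal_frame (G y0) F"
    using orthonormal_frame_exists[OF G0] .
  then have fin: "finite F" and orth: "\<And>e e'. e \<in> F \<Longrightarrow> e' \<in> F \<Longrightarrow> G y0 e e' = (if e = e' then 1 else 0)"
    and rep: "\<And>v. v = (\<Sum>e\<in>F. G y0 v e *\<^sub>R e)"
    by (auto simp: orthonormal_frame_def)
  define C where "C y = (\<Sum>e\<in>F. \<bar>G y0 (z y - z y0) e\<bar>)" for y
  define \<delta> where "\<delta> y = (\<Sum>e\<in>F. \<Sum>e'\<in>F. \<bar>G y e e' - G y0 e e'\<bar>)" for y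
  define \<rho> where "\<rho> y = (\<Sum>e\<in>F. \<bar>\<alpha> y e - G y (z y0) e\<bar>)" for y
  have C_bound: "C y \<le> \<rho> y + C y * \<delta> y"
    if y: "inner_form (G y)" "\<And>w. G y (z y) w = \<alpha> y w" for y
  proof -
    note lin = inner_form_linear[OF y(1)]
    let ?w = "z y - z y0"
    have term_bound: "\<bar>G y0 ?w e\<bar> \<le> \<bar>\<alpha> y e - G y (z y0) e\<bar> +
        (\<Sum>e'\<in>F. \<bar>G y0 ?w e'\<bar> * \<bar>G y e' e - G y0 e' e\<bar>)" if "e \<in> F" for e
    proof -
      have "G y ?w e - G y0 ?w e = G y (\<Sum>e'\<in>F. G y0 ?w e' *\<^sub>R e') e - G y0 (\<Sum>e'\<in>F. G y0 ?w e' *\<^sub>R e') e"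
        using rep[of ?w] by simp
      also have "\<dots> = (\<Sum>e'\<in>F. G y0 ?w e' * (G y e' e - G y0 e' e))"
        by (simp only: linear_sum[OF lin(2)] linear_cmul[OF lin(2)] linear_sum[OF lin0(2)]
            linear_cmul[OF lin0(2)]) (simp add: sum_subtractf right_diff_distrib)
      finally have "G y0 ?w e = (\<alpha> y e - G y (z y0) e) - (\<Sum>e'\<in>F. G y0 ?w e' * (G y e' e - G y0 e' e))"
        by (simp add: linear_diff[OF lin(2)] y(2))
      moreover have "\<bar>\<Sum>e'\<in>F. G y0 ?w e' * (G y e' e - G y0 e' e)\<bar> \<le>
          (\<Sum>e'\<in>F. \<bar>G y0 ?w e'\<bar> * \<bar>G y e' e - G y0 e' e\<bar>)"
        by (simp add: order_trans[OF sum_abs] abs_mult)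
      ultimately show ?thesis by linarith
    qed
    have "C y \<le> \<rho> y + (\<Sum>e\<in>F. \<Sum>e'\<in>F. \<bar>G y0 ?w e'\<bar> * \<bar>G y e' e - G y0 e' e\<bar>)"
      unfolding C_def \<rho>_def sum.distrib[symmetric] by (intro sum_mono term_bound)
    also have "(\<Sum>e\<in>F. \<Sum>e'\<in>F. \<bar>G y0 ?w e'\<bar> * \<bar>G y e' e - G y0 e' e\<bar>) \<le>
        (\<Sum>e\<in>F. \<Sum>e'\<in>F. C y * \<bar>G y e' e - G y0 e' e\<bar>)"
      unfolding C_def using fin by (intro sum_mono mult_right_mono member_le_sum) auto
    also have "\<dots> = C y * \<delta> y"
      unfolding \<delta>_def by (subst sum.swap) (simp add: sum_distrib_left)
    finally show ?thesis by simp
  qed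
  have "(\<delta> \<longlongrightarrow> (\<Sum>e\<in>F. \<Sum>e'\<in>F. \<bar>G y0 e e' - G y0 e e'\<bar>)) (at y0)"
    unfolding \<delta>_def using G by (intro tendsto_intros) (auto simp: isCont_def)
  then have \<delta>_lim: "(\<delta> \<longlongrightarrow> 0) (at y0)"
    by simp
  have "(\<rho> \<longlongrightarrow> (\<Sum>e\<in>F. \<bar>\<alpha> y0 e - G y0 (z y0) e\<bar>)) (at y0)"
    unfolding \<rho>_def using G \<alpha> by (intro tendsto_intros) (auto simp: isCont_def)
  then have \<rho>_lim: "((\<lambda>y. 2 * \<rho> y) \<longlongrightarrow> 0) (at y0)"
    by (simp add: z0 tendsto_mult_right_zero)
  \<comment> \<open>Once \<delta> is below 1/2 the estimate becomes C \<le> \<rho> + C / 2, whence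
    the factor 2 in front of \<rho>.\<close>
  have "eventually (\<lambda>y. \<delta> y < 1/2) (at y0)"
    using order_tendstoD(2)[OF \<delta>_lim, of "1/2"] by simp
  then have "eventually (\<lambda>y. C y \<le> 2 * \<rho> y) (at y0)"
    using ev'
  proof eventually_elim
    case (elim y)
    have "0 \<le> C y" by (simp add: C_def sum_nonneg)
    then have "C y * \<delta> y \<le> C y * (1/2)"
      using elim by (intro mult_left_mono) auto
    then show ?case
      using C_bound[of y] elim by auto
  qed
  then have C_lim: "(C \<longlongrightarrow> 0) (at y0)"
    by (intro tendsto_sandwich[OF _ _ tendsto_const \<rho>_lim]) (auto simp: C_def sum_nonneg)
  have "((\<lambda>y. G y0 (z y - z y0) e) \<longlongrightarrow> 0) (at y0)" if "e \<in> F" for e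
  proof (rule tendsto_rabs_zero_cancel, rule tendsto_sandwich[OF _ _ tendsto_const C_lim])
    show "eventually (\<lambda>y. \<bar>G y0 (z y - z y0) e\<bar> \<le> C y) (at y0)"
      unfolding C_def using fin that
      by (intro always_eventually allI member_le_sum[where f = "\<lambda>e. \<bar>G y0 (z _ - z y0) e\<bar>"]) auto
  qed auto
  then have "((\<lambda>y. \<Sum>e\<in>F. G y0 (z y - z y0) e *\<^sub>R e) \<longlongrightarrow> (\<Sum>e\<in>F. 0 *\<^sub>R e)) (at y0)"
    by (intro tendsto_intros)
  then have "((\<lambda>y. z y - z y0) \<longlongrightarrow> 0) (at y0)"
    using rep by simp
  then show ?thesis
    by (simp add: isCont_def LIM_zero_iff)
qed

text \<open>Differentiating the equation of the dual vector would presuppose the claim. Continuity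
  is obtained first, from \<open>isCont_solution\<close>, and the equation then upgrades it to
  differentiability at \<open>y0\<close>.\<close>

lemma sharp_differentiable:
  fixes G :: "'a::real_normed_vector \<Rightarrow> 'e::euclidean_space \<Rightarrow> 'e \<Rightarrow> real"
  assumes W: "open W" "y0 \<in> W"
    and form: "\<And>y. y \<in> W \<Longrightarrow> inner_form (G y)" "\<And>y. y \<in> W \<Longrightarrow> linear (\<alpha> y)"
    and G: "\<And>v w. (\<lambda>y. G y v w) differentiable (at y0)"
    and \<alpha>: "\<And>w. (\<lambda>y. \<alpha> y w) differentiable (at y0)"
  shows "(\<lambda>y. sharp (G y) (\<alpha> y)) differentiable (at y0)"
proof -
  define z where "z y = sharp (G y) (\<alpha> y)" for y
  have z: "G y (z y) w = \<alpha> y w" if "y \<in> W" for y w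
    unfolding z_def using form that by (simp add: sharp_works)
  have ev: "eventually (\<lambda>y. y \<in> W) (nhds y0)"
    using W by (rule eventually_nhds_in_open)
  have cont: "isCont z y0"
  proof (rule isCont_solution)
    show "eventually (\<lambda>y. inner_form (G y) \<and> (\<forall>w. G y (z y) w = \<alpha> y w)) (nhds y0)"
      using ev by (rule eventually_mono) (auto simp: form z)
  qed (auto intro!: differentiable_imp_continuous_within G \<alpha>)
  obtain F where F: "orthonormal_frame (G y0) F"
    using orthonormal_frame_exists[OF form(1)[OF W(2)]] .
  txt \<open>In the equation \<open>G y0 (z y) e = \<alpha> y e - (G y - G y0) (z y) e\<close> the last term is a sum of
    products of a differentiable function that vanishes at \<open>y0\<close> and a function that is only known
    to be continuous; this suffices for differentiability at \<open>y0\<close>.\<close>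
  define s where "s e y = \<alpha> y e - (\<Sum>b\<in>Basis. (G y b e - G y0 b e) * (z y \<bullet> b))" for e y
  have eq: "z y = (\<Sum>e\<in>F. s e y *\<^sub>R e)" if y: "y \<in> W" for y
  proof -
    note lin = inner_form_linear[OF form(1)[OF y]] and lin0 = inner_form_linear[OF form(1)[OF W(2)]]
    have expand: "G y' (z y) e = (\<Sum>b\<in>Basis. G y' b e * (z y \<bullet> b))" if "y' \<in> W" for y' e
    proof -
      note lin = inner_form_linear[OF form(1)[OF that]]
      have "G y' (z y) e = G y' (\<Sum>b\<in>Basis. (z y \<bullet> b) *\<^sub>R b) e"
        by (simp add: euclidean_representation)
      then show ?thesis
        by (simp only: linear_sum[OF lin(2)] linear_cmul[OF lin(2)]) (simp add: mult.commute)
    qed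
    have "s e y = G y0 (z y) e" for e
      unfolding s_def z[OF y, symmetric]
      by (simp add: expand[OF y] expand[OF W(2)] left_diff_distrib sum_subtractf)
    then show ?thesis
      using F by (auto simp: orthonormal_frame_def)
  qed
  have "s e differentiable (at y0)" for e
    unfolding s_def using cont
    by (intro differentiable_diff \<alpha> differentiable_sum ballI finite_Basis differentiable_mult_vanishing G
        differentiable_const continuous_intros) auto
  then have "(\<lambda>y. \<Sum>e\<in>F. s e y *\<^sub>R e) differentiable (at y0)"
    using F by (intro differentiable_sum ballI differentiable_scaleR differentiable_const)
      (auto simp: orthonormal_frame_def)
  then obtain D where "((\<lambda>y. \<Sum>e\<in>F. s e y *\<^sub>R e) has_derivative D) (at y0)"
    by (auto simp: differentiable_def)
  then have "(z has_derivative D) (at y0)"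
    by (rule has_derivative_transform_within_open[OF _ W]) (simp add: eq)
  then show ?thesis
    by (auto simp: z_def[abs_def] differentiable_def)
qed

section \<open>The metric \<open>dt\<^sup>2 + k\<^sub>t\<close> in a product of coordinate domains\<close>

lemma smooth_on_differentiable:
  assumes "smooth_on S f" "x \<in> S"
  shows "f differentiable (at x)"
proof -
  have "Ck_on (Suc 0) S f" using assms(1) unfolding smooth_on_def by (rule spec)
  then show ?thesis using assms(2) by simp
qed

lemma smooth_on_frechet_derivative:
  assumes "smooth_on S f"
  shows "smooth_on S (\<lambda>x. frechet_derivative f (at x) v)"
  unfolding smooth_on_def
proof
  fix k
  have "Ck_on (Suc k) S f" using assms unfolding smooth_on_def by (rule spec)
  then show "Ck_on k S (\<lambda>x. frechet_derivative f (at x) v)" by simp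
qed

text \<open>\<open>frechet_derivative\<close> chooses among all derivatives. The two functions have
  the same ones at \<open>x\<close>, so the choices coincide, even if there is no derivative at
  all.\<close>

lemma frechet_derivative_cong_open:
  assumes "open S" "x \<in> S" "\<And>y. y \<in> S \<Longrightarrow> f y = g y"
  shows "frechet_derivative f (at x) = frechet_derivative g (at x)"
proof -
  have "(f has_derivative D) (at x) \<longleftrightarrow> (g has_derivative D) (at x)" for D
    using has_derivative_transform_within_open[of f D x UNIV S g]
      has_derivative_transform_within_open[of g D x UNIV S f] assms by auto
  then show ?thesis
    by (simp add: frechet_derivative_def)
qed

lemma differentiable_cong_open:
  assumes "open S" "x \<in> S" "\<And>y. y \<in> S \<Longrightarrow> f y = g y" "f differentiable (at x)"
  shows "g differentiable (at x)"
proof -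
  obtain D where "(f has_derivative D) (at x)"
    using assms(4) by (auto simp: differentiable_def)
  then have "(g has_derivative D) (at x)"
    using assms(1,2,3) by (rule has_derivative_transform_within_open)
  then show ?thesis
    by (auto simp: differentiable_def)
qed

lemma has_field_derivative_slice:
  fixes F :: "real \<times> 'e::euclidean_space \<Rightarrow> real"
  assumes "F differentiable (at (t, x))"
  shows "((\<lambda>s. F (s, x)) has_real_derivative frechet_derivative F (at (t, x)) (1, 0)) (at t)"
proof -
  have F: "(F has_derivative frechet_derivative F (at (t, x))) (at (t, x))"
    using assms by (simp add: frechet_derivative_works)
  have "((\<lambda>s. (s, x)) has_derivative (\<lambda>h. (h, 0))) (at t)"
    by (auto intro!: derivative_eq_intros)
  then have "((\<lambda>s. F (s, x)) has_derivative (\<lambda>h. frechet_derivative F (at (t, x)) (h, 0))) (at t)"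
    using F by (rule has_derivative_compose)
  moreover
  have "frechet_derivative F (at (t, x)) (h, 0) = frechet_derivative F (at (t, x)) (1, 0) * h" for h
  proof -
    have "frechet_derivative F (at (t, x)) (h *\<^sub>R (1, 0)) = h *\<^sub>R frechet_derivative F (at (t, x)) (1, 0)"
      using F by (intro linear_cmul has_derivative_linear)
    then show ?thesis by simp
  qed
  then have "(\<lambda>h. frechet_derivative F (at (t, x)) (h, 0)) = (*) (frechet_derivative F (at (t, x)) (1, 0))"
    by (rule ext)
  ultimately show ?thesis
    unfolding has_field_derivative_def by simp
qed

text \<open>The basis vector \<open>(1, 0)\<close> contributes nothing, because the image has first
  component 0; the others reproduce the trace of \<open>T\<close>.\<close>

lemma endo_trace_snd:
  "endo_trace (\<lambda>z::real \<times> 'e::euclidean_space. (0, T (snd z))) = endo_trace T"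
proof -
  have "inj_on (\<lambda>u. (u::real, 0::'e)) Basis" "inj_on (\<lambda>u. (0::real, u::'e)) Basis"
    by (auto intro!: inj_onI)
  then show ?thesis
    unfolding endo_trace_def Basis_prod_def
    by (subst sum.union_disjoint) (auto simp: sum.reindex)
qed

text \<open>Smoothness is assumed of \<open>G\<close> and passes to \<open>k\<close> through
  \<open>G_eq\<close>. This is how \<open>k\<close> gets its regularity in t and x jointly.\<close>

locale product_metric =
  fixes I :: "real set" and V :: "'e::euclidean_space set"
    and G :: "(real \<times> 'e) local_metric" and k :: "real \<Rightarrow> 'e local_metric"
  assumes open_I: "open I" and open_V: "open V"
    and k_form: "\<And>t x. \<lbrakk>t \<in> I; x \<in> V\<rbrakk> \<Longrightarrow> inner_form (k t x)"
    and G_smooth: "\<And>v w. smooth_on (I \<times> V) (\<lambda>y. G y v w)"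
    and G_eq: "\<And>t x v w. \<lbrakk>t \<in> I; x \<in> V\<rbrakk> \<Longrightarrow> G (t, x) v w = fst v * fst w + k t x (snd v) (snd w)"
begin

lemma open_IV: "open (I \<times> V)"
  using open_I open_V by (rule open_Times)

lemma k_smooth: "smooth_on (I \<times> V) (\<lambda>y. G y (0, v) (0, w))"
  by (rule G_smooth)

lemma k_eq: "\<lbrakk>t \<in> I; x \<in> V\<rbrakk> \<Longrightarrow> G (t, x) (0, v) (0, w) = k t x v w"
  by (simp add: G_eq)

lemma G_form:
  assumes "t \<in> I" "x \<in> V"
  shows "inner_form (G (t, x))"
proof -
  note k = k_form[OF assms]
  note lin = inner_form_linear[OF k]
  have "bilinear (G (t, x))"
    unfolding bilinear_def
    by (auto intro!: linearI simp: G_eq[OF assms] linear_add[OF lin(1)] linear_add[OF lin(2)]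
        linear_cmul[OF lin(1)] linear_cmul[OF lin(2)] algebra_simps)
  moreover have "G (t, x) v w = G (t, x) w v" for v w
    by (simp add: G_eq[OF assms] inner_form_sym[OF k, of "snd v"])
  moreover have "G (t, x) v v > 0" if "v \<noteq> 0" for v
  proof (cases "snd v = 0")
    case True
    then have "fst v \<noteq> 0" using that by (metis prod_eq_iff fst_zero snd_zero)
    then show ?thesis
      by (simp add: G_eq[OF assms] True inner_form_zero[OF k] zero_less_mult_iff not_less_iff_gr_or_eq)
         linarith
  next
    case False
    then have "k t x (snd v) (snd v) > 0" using k by (auto simp: inner_form_def)
    then show ?thesis
      by (simp add: G_eq[OF assms] add_nonneg_pos)
  qed
  ultimately show ?thesis by (simp add: inner_form_def)
qed

text \<open>The t-derivative of \<open>k\<close>, written as a directional derivative of a component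
  of \<open>G\<close>: in this form it is again smooth on \<open>I \<times> V\<close>, which
  \<open>deriv\<close> in the single variable t would not show.\<close>

definition dk :: "real \<Rightarrow> 'e \<Rightarrow> 'e \<Rightarrow> 'e \<Rightarrow> real" where
  "dk t x v w = frechet_derivative (\<lambda>y. G y (0, v) (0, w)) (at (t, x)) (1, 0)"

lemma k_has_derivative:
  assumes "t \<in> I" "x \<in> V"
  shows "((\<lambda>s. k s x v w) has_real_derivative dk t x v w) (at t)"
  unfolding dk_def
  by (rule has_field_derivative_transform_within_open[OF
        has_field_derivative_slice[OF smooth_on_differentiable[OF k_smooth]] open_I])
    (use assms in \<open>auto simp: k_eq\<close>)

lemma dk_sym:
  assumes "t \<in> I" "x \<in> V"
  shows "dk t x v w = dk t x w v"
proof (rule DERIV_unique[OF k_has_derivative[OF assms]])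
  show "((\<lambda>s. k s x v w) has_real_derivative dk t x w v) (at t)"
    by (rule has_field_derivative_transform_within_open[OF k_has_derivative[OF assms] open_I assms(1)])
      (metis assms(2) inner_form_sym k_form)
qed

lemma dk_linear:
  assumes t: "t \<in> I" and x: "x \<in> V"
  shows "linear (dk t x v)" "linear (\<lambda>v. dk t x v w)"
proof -
  show "linear (dk t x v)" for v
  proof (rule linearI)
    fix w w' and r :: real
    show "dk t x v (w + w') = dk t x v w + dk t x v w'"
    proof (rule DERIV_unique[OF k_has_derivative[OF t x]])
      show "((\<lambda>s. k s x v (w + w')) has_real_derivative dk t x v w + dk t x v w') (at t)"
        by (rule has_field_derivative_transform_within_open[OF
              DERIV_add[OF k_has_derivative[OF t x, of v w] k_has_derivative[OF t x, of v w']] open_I t])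
          (simp add: linear_add[OF inner_form_linear(1)[OF k_form[OF _ x]]])
    qed
    show "dk t x v (r *\<^sub>R w) = r *\<^sub>R dk t x v w"
    proof (rule DERIV_unique[OF k_has_derivative[OF t x]])
      show "((\<lambda>s. k s x v (r *\<^sub>R w)) has_real_derivative r *\<^sub>R dk t x v w) (at t)"
        unfolding real_scaleR_def
        by (rule has_field_derivative_transform_within_open[OF
              DERIV_cmult[OF k_has_derivative[OF t x, of v w]] open_I t])
          (simp add: linear_cmul[OF inner_form_linear(1)[OF k_form[OF _ x]]])
    qed
  qed
  then have "linear (\<lambda>v. dk t x w v)" .
  then show "linear (\<lambda>v. dk t x v w)"
    by (simp add: dk_sym[OF t x, of _ w])
qed

text \<open>\<open>shape_op\<close> with \<open>dk\<close> in place of \<open>deriv\<close>. The two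
  agree over \<open>I\<close> and \<open>V\<close>, and this version has the shape required by
  \<open>sharp_differentiable\<close>.\<close>

definition L :: "real \<Rightarrow> 'e \<Rightarrow> 'e \<Rightarrow> 'e" where
  "L t x v = sharp (k t x) (\<lambda>w. dk t x v w / 2)"

lemma shape_op_eq_L: "\<lbrakk>t \<in> I; x \<in> V\<rbrakk> \<Longrightarrow> shape_op k t x v = L t x v"
  by (simp add: shape_op_def L_def DERIV_imp_deriv[OF k_has_derivative])

lemma half_dk_linear:
  assumes "t \<in> I" "x \<in> V"
  shows "linear (\<lambda>w. dk t x v w / 2)" "linear (\<lambda>v. dk t x v w / 2)"
  using dk_linear[OF assms] by (auto simp: linear_iff add_divide_distrib)

lemma L_linear:
  assumes "t \<in> I" "x \<in> V"
  shows "linear (L t x)"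
  unfolding L_def[abs_def] by (intro sharp_linear k_form half_dk_linear assms)

lemma k_L:
  assumes "t \<in> I" "x \<in> V"
  shows "k t x (L t x v) w = dk t x v w / 2"
  unfolding L_def by (rule sharp_works[OF k_form half_dk_linear(1)]) (use assms in auto)

text \<open>Both sides are half of \<open>dk\<close>, which inherits the symmetry of
  \<open>k\<close>.\<close>

lemma L_self_adjoint:
  assumes "t \<in> I" "x \<in> V"
  shows "k t x (L t x v) w = k t x v (L t x w)"
  using inner_form_sym[OF k_form[OF assms], of v] by (simp add: k_L[OF assms] dk_sym[OF assms, of v])

lemma L_differentiable:
  assumes "t \<in> I" "x \<in> V"
  shows "(\<lambda>y. L (fst y) (snd y) v) differentiable (at (t, x))"
proof -
  have tx: "(t, x) \<in> I \<times> V" using assms by simp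
  have "(\<lambda>y. sharp (k (fst y) (snd y)) (\<lambda>w. dk (fst y) (snd y) v w / 2)) differentiable (at (t, x))"
  proof (rule sharp_differentiable[OF open_IV tx])
    fix v w
    show "(\<lambda>y. k (fst y) (snd y) v w) differentiable (at (t, x))"
      by (rule differentiable_cong_open[OF open_IV tx _ smooth_on_differentiable[OF k_smooth tx]])
        (auto simp: k_eq)
  next
    fix w
    have "(\<lambda>y. dk (fst y) (snd y) v w) differentiable (at (t, x))"
      unfolding dk_def prod.collapse
      by (rule smooth_on_differentiable[OF smooth_on_frechet_derivative[OF k_smooth] tx])
    then show "(\<lambda>y. dk (fst y) (snd y) v w / 2) differentiable (at (t, x))"
      by (rule differentiable_compose[of "\<lambda>r. r / 2", rotated, unfolded o_def])
        (auto intro!: derivative_intros)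
  qed (auto intro: k_form half_dk_linear)
  then show ?thesis
    by (simp add: L_def)
qed

section \<open>Connection, curvature and Hessian in the direction of \<open>(1, 0)\<close>\<close>

lemma frechet_derivative_G_dt:
  assumes "t \<in> I" "x \<in> V"
  shows "frechet_derivative (\<lambda>y. G y (1, 0) w) (at (t, x)) = (\<lambda>_. 0)"
    "frechet_derivative (\<lambda>y. G y w (1, 0)) (at (t, x)) = (\<lambda>_. 0)"
proof -
  have "frechet_derivative (\<lambda>y. G y (1, 0) w) (at (t, x)) = frechet_derivative (\<lambda>y. fst w) (at (t, x))"
    "frechet_derivative (\<lambda>y. G y w (1, 0)) (at (t, x)) = frechet_derivative (\<lambda>y. fst w) (at (t, x))"
    using assms by (intro frechet_derivative_cong_open[OF open_IV];
      auto simp: G_eq inner_form_zero[OF k_form])+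
  then show "frechet_derivative (\<lambda>y. G y (1, 0) w) (at (t, x)) = (\<lambda>_. 0)"
    "frechet_derivative (\<lambda>y. G y w (1, 0)) (at (t, x)) = (\<lambda>_. 0)"
    by simp_all
qed

lemma frechet_derivative_G_along_dt:
  assumes "t \<in> I" "x \<in> V"
  shows "frechet_derivative (\<lambda>y. G y v w) (at (t, x)) (1, 0) = dk t x (snd v) (snd w)"
proof -
  have "((\<lambda>s. G (s, x) v w) has_real_derivative frechet_derivative (\<lambda>y. G y v w) (at (t, x)) (1, 0)) (at t)"
    using assms by (intro has_field_derivative_slice smooth_on_differentiable[OF G_smooth]) auto
  moreover have "((\<lambda>s. G (s, x) v w) has_real_derivative 0 + dk t x (snd v) (snd w)) (at t)"
    by (rule has_field_derivative_transform_within_open[OF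
          DERIV_add[OF DERIV_const k_has_derivative[OF assms]] open_I assms(1)])
      (simp add: G_eq assms)
  ultimately show ?thesis
    using DERIV_unique by fastforce
qed

text \<open>In the Koszul formula the products with \<open>(1, 0)\<close> are constant, so only the
  derivative along \<open>(1, 0)\<close> survives; it is \<open>dk\<close>, and half of it is what
  \<open>L\<close> represents. For z = \<open>(1, 0)\<close> the result is 0: the t-curves are
  geodesics.\<close>

lemma christoffel_dt:
  assumes "t \<in> I" "x \<in> V"
  shows "christoffel G (t, x) z (1, 0) = (0, L t x (snd z))"
    "christoffel G (t, x) (1, 0) z = (0, L t x (snd z))"
  unfolding christoffel_def
  by (rule sharp_eqI[OF G_form[OF assms]],
      simp add: frechet_derivative_G_dt[OF assms] frechet_derivative_G_along_dt[OF assms]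
        G_eq[OF assms] k_L[OF assms])+

definition dL :: "real \<Rightarrow> 'e \<Rightarrow> 'e \<Rightarrow> 'e" where
  "dL t x v = frechet_derivative (\<lambda>y. L (fst y) (snd y) v) (at (t, x)) (1, 0)"

text \<open>Of the four terms of \<open>riemann\<close>, the two containing the covariant derivative
  of \<open>(1, 0)\<close> along itself vanish. The other two are -L' and -L^2 applied to the
  hypersurface component of \<open>z\<close>.\<close>

lemma riemann_dt:
  assumes "t \<in> I" "x \<in> V"
  shows "riemann G (t, x) z (1, 0) (1, 0) = - (0, dL t x (snd z) + L t x (L t x (snd z)))"
proof -
  have tx: "(t, x) \<in> I \<times> V" using assms by simp
  have L0: "L t x 0 = 0" if "t \<in> I" "x \<in> V" for t x
    using linear_0[OF L_linear[OF that]] .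
  have christoffel_zero: "christoffel G (t, x) z (0, 0) = 0"
    unfolding christoffel_def
  proof (rule sharp_eqI[OF G_form[OF assms]])
    fix w
    have "frechet_derivative (\<lambda>y. G y (0, 0) w) (at (t, x)) = frechet_derivative (\<lambda>y. 0) (at (t, x))"
      "frechet_derivative (\<lambda>y. G y z (0, 0)) (at (t, x)) = frechet_derivative (\<lambda>y. 0) (at (t, x))"
      by (intro frechet_derivative_cong_open[OF open_IV tx];
          auto simp: G_eq inner_form_zero[OF k_form])+
    moreover have "frechet_derivative (\<lambda>y. G y z w) (at (t, x)) (0, 0) = 0"
      using linear_0[OF linear_frechet_derivative[OF smooth_on_differentiable[OF G_smooth tx]]]
      by (simp add: zero_prod_def)
    ultimately show "G (t, x) 0 w =
        (frechet_derivative (\<lambda>y. G y (0, 0) w) (at (t, x)) z +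
         frechet_derivative (\<lambda>y. G y z w) (at (t, x)) (0, 0) -
         frechet_derivative (\<lambda>y. G y z (0, 0)) (at (t, x)) w) / 2"
      by (simp add: inner_form_zero[OF G_form[OF assms]])
  qed
  have 1: "frechet_derivative (\<lambda>y. christoffel G y (1, 0) (1, 0)) (at (t, x)) = (\<lambda>_. 0)"
  proof -
    have "frechet_derivative (\<lambda>y. christoffel G y (1, 0) (1, 0)) (at (t, x)) =
        frechet_derivative (\<lambda>y. 0) (at (t, x))"
      by (rule frechet_derivative_cong_open[OF open_IV tx]) (auto simp: christoffel_dt L0 zero_prod_def)
    then show ?thesis by simp
  qed
  have 2: "frechet_derivative (\<lambda>y. christoffel G y z (1, 0)) (at (t, x)) (1, 0) = (0, dL t x (snd z))"
  proof -
    have "((\<lambda>y. (0::real, L (fst y) (snd y) (snd z))) has_derivative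
        (\<lambda>h. (0, frechet_derivative (\<lambda>y. L (fst y) (snd y) (snd z)) (at (t, x)) h))) (at (t, x))"
      using L_differentiable[OF assms]
      by (intro has_derivative_Pair has_derivative_const) (simp add: frechet_derivative_works)
    then have "((\<lambda>y. christoffel G y z (1, 0)) has_derivative
        (\<lambda>h. (0, frechet_derivative (\<lambda>y. L (fst y) (snd y) (snd z)) (at (t, x)) h))) (at (t, x))"
      by (rule has_derivative_transform_within_open[OF _ open_IV tx]) (auto simp: christoffel_dt)
    then show ?thesis
      by (simp add: frechet_derivative_at[symmetric] dL_def)
  qed
  show ?thesis
    unfolding riemann_def 1 2 by (simp add: christoffel_dt[OF assms] L0[OF assms] christoffel_zero)
qed

text \<open>In fixed coordinates a trace is a finite sum of components and commutes with d/dt. This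
  turns the tr L' of the Ricci component into the derivative of \<open>H\<close>.\<close>

lemma endo_trace_L_has_derivative:
  assumes "t \<in> I" "x \<in> V"
  shows "((\<lambda>s. endo_trace (L s x)) has_real_derivative endo_trace (dL t x)) (at t)"
proof -
  have "((\<lambda>s. L s x b \<bullet> b) has_real_derivative dL t x b \<bullet> b) (at t)" for b
  proof -
    have D: "((\<lambda>y. L (fst y) (snd y) b \<bullet> b) has_derivative
        (\<lambda>h. frechet_derivative (\<lambda>y. L (fst y) (snd y) b) (at (t, x)) h \<bullet> b)) (at (t, x))"
      using L_differentiable[OF assms, of b]
      by (intro has_derivative_inner_left) (simp add: frechet_derivative_works)
    then have "(\<lambda>y. L (fst y) (snd y) b \<bullet> b) differentiable (at (t, x))"
      by (auto simp: differentiable_def)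
    from has_field_derivative_slice[OF this] show ?thesis
      by (simp add: frechet_derivative_at[OF D, symmetric] dL_def)
  qed
  then show ?thesis
    unfolding endo_trace_def by (intro DERIV_sum)
qed

lemma ricci_dt:
  assumes "t \<in> I" "x \<in> V"
  shows "ricci G (t, x) (1, 0) (1, 0) = - endo_trace (dL t x) - endo_trace (\<lambda>v. L t x (L t x v))"
proof -
  have "ricci G (t, x) (1, 0) (1, 0) = endo_trace (\<lambda>v. - (dL t x v + L t x (L t x v)))"
    by (simp only: ricci_def riemann_dt[OF assms] uminus_Pair minus_zero
        endo_trace_snd[of "\<lambda>v. - (dL t x v + L t x (L t x v))"])
  also have "\<dots> = - endo_trace (dL t x) - endo_trace (\<lambda>v. L t x (L t x v))"
    by (simp add: endo_trace_def inner_diff_left sum_subtractf sum_negf)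
  finally show ?thesis .
qed

text \<open>The Christoffel term vanishes on the pair \<open>(1, 0)\<close>, \<open>(1, 0)\<close>,
  which leaves the second t-derivative. \<open>f\<close> is controlled on \<open>I\<close> only;
  openness of \<open>I\<close> is enough to identify \<open>deriv f\<close> there.\<close>

lemma hessian_dt:
  fixes F :: "real \<times> 'e \<Rightarrow> real"
  assumes "t \<in> I" "x \<in> V" and F: "smooth_on (I \<times> V) F"
    and f: "\<And>s. s \<in> I \<Longrightarrow> F (s, x) = f s"
  shows "(deriv f has_real_derivative hessian G F (t, x) (1, 0) (1, 0)) (at t)"
proof -
  let ?F' = "\<lambda>y. frechet_derivative F (at y) (1, 0)"
  have "linear (frechet_derivative F (at (t, x)))"
    using smooth_on_differentiable[OF F] assms(1,2) by (intro linear_frechet_derivative) auto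
  then have "hessian G F (t, x) (1, 0) (1, 0) = frechet_derivative ?F' (at (t, x)) (1, 0)"
    using linear_0[OF L_linear[OF assms(1,2)]]
    by (simp add: hessian_def christoffel_dt[OF assms(1,2)] linear_0 flip: zero_prod_def)
  then have *: "((\<lambda>s. ?F' (s, x)) has_real_derivative hessian G F (t, x) (1, 0) (1, 0)) (at t)"
    using has_field_derivative_slice[OF smooth_on_differentiable[OF smooth_on_frechet_derivative[OF F]]]
      assms(1,2) by simp
  have "deriv f s = ?F' (s, x)" if "s \<in> I" for s
  proof (rule DERIV_imp_deriv)
    show "(f has_real_derivative ?F' (s, x)) (at s)"
      by (rule has_field_derivative_transform_within_open[OF
            has_field_derivative_slice[OF smooth_on_differentiable[OF F]] open_I])
        (use that f assms(2) in auto)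
  qed
  then show ?thesis
    by (intro has_field_derivative_transform_within_open[OF * open_I assms(1)]) auto
qed

text \<open>\<open>D\<close> is tr (L^2): the soliton equation gives f'' = tr L' + tr (L^2), and the
  first summand is H'.\<close>

lemma soliton_has_derivative:
  fixes F :: "real \<times> 'e \<Rightarrow> real"
  assumes t: "t \<in> I" and x: "x \<in> V" and F: "smooth_on (I \<times> V) F"
    and f: "\<And>s. s \<in> I \<Longrightarrow> F (s, x) = f s"
    and H: "\<And>s. s \<in> I \<Longrightarrow> endo_trace (shape_op k s x) = H s"
    and soliton: "ricci G (t, x) (1, 0) (1, 0) + hessian G F (t, x) (1, 0) (1, 0) = 0"
  obtains D where "D \<ge> 0" "((\<lambda>s. deriv f s - H s) has_real_derivative D) (at t)"
proof
  show "endo_trace (\<lambda>v. L t x (L t x v)) \<ge> 0"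
    by (intro endo_trace_square_nonneg[OF k_form[OF t x]] L_linear L_self_adjoint t x)
  have "endo_trace (L s x) = H s" if "s \<in> I" for s
    using H[OF that] shape_op_eq_L[OF that x] by (simp add: endo_trace_def)
  then have "(H has_real_derivative endo_trace (dL t x)) (at t)"
    by (rule has_field_derivative_transform_within_open[OF endo_trace_L_has_derivative[OF t x] open_I t])
  from DERIV_diff[OF hessian_dt[OF t x F f] this]
  show "((\<lambda>s. deriv f s - H s) has_real_derivative endo_trace (\<lambda>v. L t x (L t x v))) (at t)"
    using soliton by (simp add: ricci_dt[OF t x] algebra_simps)
qed

end

text \<open>The sign of \<phi> decides the direction: the inverse square of an increasing function
  decreases where the function is positive and increases where it is negative. Continuity excludes a
  change of sign on the interval.\<close>

lemma powi_minus2_monotone: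
  fixes \<phi> :: "real \<Rightarrow> real"
  assumes mono: "mono_on J \<phi>" and cont: "continuous_on J \<phi>" and J: "is_interval J"
    and nz: "\<And>t. t \<in> J \<Longrightarrow> \<phi> t \<noteq> 0"
  shows "mono_on J (\<lambda>t. \<phi> t powi (-2)) \<or> antimono_on J (\<lambda>t. \<phi> t powi (-2))"
proof -
  have eq: "\<phi> t powi (-2) = inverse ((\<phi> t)\<^sup>2)" for t
    by (simp add: power_int_minus)
  have "connected (\<phi> ` J)"
    using cont J by (intro connected_continuous_image is_interval_connected)
  then have "is_interval (\<phi> ` J)"
    by (simp add: is_interval_connected_1)
  moreover have "0 \<notin> \<phi> ` J"
    using nz by auto
  ultimately consider "\<forall>t\<in>J. \<phi> t > 0" | "\<forall>t\<in>J. \<phi> t < 0"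
    by (smt (verit, ccfv_threshold) image_eqI is_interval_1 nz)
  then show ?thesis
  proof cases
    case 1
    have "inverse ((\<phi> t)\<^sup>2) \<le> inverse ((\<phi> s)\<^sup>2)" if "s \<in> J" "t \<in> J" "s \<le> t" for s t
      using that 1 mono
      by (intro le_imp_inverse_le power_mono) (auto simp: monotone_on_def intro: less_imp_le)
    then have "antimono_on J (\<lambda>t. inverse ((\<phi> t)\<^sup>2))"
      by (auto simp: monotone_on_def)
    then show ?thesis by (simp add: eq)
  next
    case 2
    have "inverse ((\<phi> s)\<^sup>2) \<le> inverse ((\<phi> t)\<^sup>2)" if "s \<in> J" "t \<in> J" "s \<le> t" for s t
    proof (rule le_imp_inverse_le)
      have "(- \<phi> t)\<^sup>2 \<le> (- \<phi> s)\<^sup>2"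
        using that 2 mono by (intro power_mono) (auto simp: monotone_on_def intro: less_imp_le)
      then show "(\<phi> t)\<^sup>2 \<le> (\<phi> s)\<^sup>2" by simp
    qed (use 2 that in auto)
    then have "mono_on J (\<lambda>t. inverse ((\<phi> t)\<^sup>2))"
      by (auto simp: monotone_on_def)
    then show ?thesis by (simp add: eq)
  qed
qed

section \<open>Transport of charts by a diffeomorphism\<close>

text \<open>The derivatives in \<open>Ck_on\<close> are unrestricted, so the agreement must hold on
  an open set. Both functions are generalised because the induction passes to their directional
  derivatives.\<close>

lemma Ck_on_cong:
  assumes "open S" "\<And>x. x \<in> S \<Longrightarrow> f x = g x" "Ck_on k S f"
  shows "Ck_on k S g"
  using assms(2,3)
proof (induction k arbitrary: f g)
  case 0
  then show ?case by (metis Ck_on.simps(1) continuous_on_cong)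
next
  case (Suc k)
  have "g differentiable (at x)" if "x \<in> S" for x
    using differentiable_cong_open[OF \<open>open S\<close> that Suc.prems(1)] Suc.prems(2) that by simp
  moreover have "Ck_on k S (\<lambda>x. frechet_derivative g (at x) v)" for v
  proof (rule Suc.IH)
    show "frechet_derivative f (at x) v = frechet_derivative g (at x) v" if "x \<in> S" for x
      using frechet_derivative_cong_open[OF \<open>open S\<close> that Suc.prems(1)] by simp
    show "Ck_on k S (\<lambda>x. frechet_derivative f (at x) v)"
      using Suc.prems(2) by simp
  qed
  ultimately show ?case by simp
qed

lemma smooth_on_cong:
  assumes "open S" "\<And>x. x \<in> S \<Longrightarrow> f x = g x" "smooth_on S f"
  shows "smooth_on S g"
  unfolding smooth_on_def
proof
  fix k
  have "Ck_on k S f" using assms(3) unfolding smooth_on_def by (rule spec)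
  with assms(1,2) show "Ck_on k S g" by (rule Ck_on_cong)
qed

lemma is_chart_open_image:
  assumes "is_chart c" "open T" "T \<subseteq> fst c"
  shows "open (snd c ` T)"
proof -
  have hom: "homeomorphism (fst c) (chart_image c) (snd c) (chart_inv c)" "open (chart_image c)"
    using assms(1) by (auto simp: is_chart_def)
  have "openin (top_of_set (fst c)) T"
    using assms(2,3) by (simp add: open_subset)
  with hom show ?thesis
    using homeomorphism_imp_open_map openin_open_trans by blast
qed

lemma is_chart_product_chart:
  assumes "is_chart c" "open I"
  shows "is_chart (product_chart I c)"
    and "chart_image (product_chart I c) = I \<times> chart_image c"
    and "\<lbrakk>t \<in> I; x \<in> chart_image c\<rbrakk> \<Longrightarrow> chart_inv (product_chart I c) (t, x) = (t, chart_inv c x)"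
proof -
  have c: "open (fst c)" "open (chart_image c)" "inj_on (snd c) (fst c)"
    "homeomorphism (fst c) (chart_image c) (snd c) (chart_inv c)"
    using assms(1) by (auto simp: is_chart_def)
  show image: "chart_image (product_chart I c) = I \<times> chart_image c"
    by (force simp: product_chart_def)
  have inj: "inj_on (snd (product_chart I c)) (fst (product_chart I c))"
    using c(3) by (auto simp: product_chart_def inj_on_def)
  have inv: "chart_inv (product_chart I c) (t, x) = (t, chart_inv c x)"
    if "t \<in> I" "x \<in> chart_image c" for t x
    using that by (intro inv_into_f_eq[OF inj])
      (auto simp: product_chart_def f_inv_into_f inv_into_into)
  then show "\<lbrakk>t \<in> I; x \<in> chart_image c\<rbrakk> \<Longrightarrow> chart_inv (product_chart I c) (t, x) = (t, chart_inv c x)" .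
  have "continuous_on (I \<times> fst c) (\<lambda>y. (fst y, snd c (snd y)))"
    "continuous_on (I \<times> chart_image c) (\<lambda>y. (fst y, chart_inv c (snd y)))"
    by (intro continuous_on_Pair continuous_on_fst continuous_on_id
        continuous_on_compose2[OF homeomorphism_cont1[OF c(4)] continuous_on_snd[OF continuous_on_id]]
        continuous_on_compose2[OF homeomorphism_cont2[OF c(4)] continuous_on_snd[OF continuous_on_id]];
        simp add: image_subset_iff)+
  then have "homeomorphism (I \<times> fst c) (I \<times> chart_image c)
      (\<lambda>y. (fst y, snd c (snd y))) (\<lambda>y. (fst y, chart_inv c (snd y)))"
  proof (rule homeomorphismI)
    have "chart_inv c (snd c q) = q" if "q \<in> fst c" for q
      using c(3) that by simp
    moreover have "snd c (chart_inv c y) = y" "chart_inv c y \<in> fst c" if "y \<in> chart_image c" for y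
      using that by (auto simp: f_inv_into_f inv_into_into)
    ultimately show "(\<lambda>y. (fst y, chart_inv c (snd y))) ` (I \<times> chart_image c) \<subseteq> I \<times> fst c"
      "\<And>y. y \<in> I \<times> fst c \<Longrightarrow>
         (fst (fst y, snd c (snd y)), chart_inv c (snd (fst y, snd c (snd y)))) = y"
      "\<And>y. y \<in> I \<times> chart_image c \<Longrightarrow>
         (fst (fst y, chart_inv c (snd y)), snd c (snd (fst y, chart_inv c (snd y)))) = y"
      by auto
  qed auto
  then have "homeomorphism (fst (product_chart I c)) (I \<times> chart_image c)
      (snd (product_chart I c)) (chart_inv (product_chart I c))"
    by (rule homeomorphism_cong) (use inv in \<open>auto simp: product_chart_def\<close>)
  then show "is_chart (product_chart I c)"
    using c(1,2) assms(2) inj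
    by (simp add: is_chart_def image open_Times) (simp add: product_chart_def open_Times)
qed

text \<open>A maximal atlas contains every chart compatible with its members, so it is enough to
  carry \<open>p\<close> over by \<Phi> and check compatibility. The other two conclusions say that
  in coordinates nothing has changed.\<close>

lemma pushforward_chart:
  fixes A :: "('m::{t2_space,second_countable_topology}, 'e::euclidean_space) chart set"
    and B :: "('n::topological_space, 'e) chart set"
  assumes A: "smooth_structure A" and diffeo: "diffeomorphism B S A U \<Phi>" and "open U"
    and p: "p \<in> B" "is_chart p" "fst p \<subseteq> S"
  defines "c \<equiv> (\<Phi> ` fst p, snd p \<circ> inv_into S \<Phi>)"
  shows "c \<in> A" and "chart_image c = chart_image p"
    and "\<And>y. y \<in> chart_image p \<Longrightarrow> chart_inv c y = \<Phi> (chart_inv p y)"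
proof -
  let ?\<Psi> = "inv_into S \<Phi>"
  have inj: "inj_on \<Phi> S" and img: "\<Phi> ` S = U"
    and sm: "smooth_map B S A \<Phi>" "smooth_map A U B ?\<Psi>"
    using diffeo by (auto simp: diffeomorphism_def bij_betw_def)
  have cont: "continuous_on S \<Phi>" "continuous_on U ?\<Psi>"
    using sm by (auto simp: smooth_map_def)
  have p': "open (fst p)" "open (chart_image p)" "inj_on (snd p) (fst p)"
    "homeomorphism (fst p) (chart_image p) (snd p) (chart_inv p)"
    using p(2) by (auto simp: is_chart_def)
  have \<Psi>: "?\<Psi> (\<Phi> q) = q" if "q \<in> S" for q
    using inj that by simp
  \<comment> \<open>As a preimage under the continuous inverse of \<Phi>, the domain is seen to be
    open.\<close>
  have fst_c: "fst c = U \<inter> ?\<Psi> -` fst p"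
  proof
    show "fst c \<subseteq> U \<inter> ?\<Psi> -` fst p"
      using p(3) img \<Psi> by (auto simp: c_def)
    have "\<Phi> (?\<Psi> q) = q" if "q \<in> U" for q
      using that img by (simp add: f_inv_into_f)
    then show "U \<inter> ?\<Psi> -` fst p \<subseteq> fst c"
      by (auto simp: c_def intro: rev_image_eqI)
  qed
  have open_c: "open (fst c)"
    unfolding fst_c using cont(2) \<open>open U\<close> p'(1) by (rule continuous_open_preimage)
  have snd_c: "snd c (\<Phi> q) = snd p q" if "q \<in> fst p" for q
    using that p(3) \<Psi> by (auto simp: c_def)
  show image: "chart_image c = chart_image p"
    using snd_c by (force simp: c_def)
  have inj_c: "inj_on (snd c) (fst c)"
    using p'(3) snd_c by (auto simp: c_def inj_on_def)
  show inv: "chart_inv c y = \<Phi> (chart_inv p y)" if "y \<in> chart_image p" for y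
    using that snd_c by (intro inv_into_f_eq[OF inj_c])
      (auto simp: c_def inv_into_into f_inv_into_f)
  have "homeomorphism (fst c) (fst p) ?\<Psi> \<Phi>"
    using cont p(3) \<Psi> img
    by (intro homeomorphismI) (auto simp: c_def intro: continuous_on_subset)
  from homeomorphism_compose[OF this p'(4)]
  have "homeomorphism (fst c) (chart_image p) (snd c) (chart_inv c)"
  proof (rule homeomorphism_cong)
    show "chart_inv c y = (\<Phi> \<circ> chart_inv p) y" if "y \<in> chart_image p" for y
      using inv[OF that] by simp
  qed (simp_all add: c_def)
  then have chart: "is_chart c"
    using open_c p'(2) inj_c by (simp add: is_chart_def image)
  \<comment> \<open>The transition from \<open>c\<close> to \<open>d\<close> is the local
    representative of \<Phi> with respect to \<open>p\<close> and \<open>d\<close>, and the reverse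
    transition is that of the inverse of \<Phi>. Their smoothness is the definition of a
    diffeomorphism.\<close>
  have "compatible c d" if d: "d \<in> A" for d
    unfolding compatible_def transition_def
  proof
    have "fst p \<inter> S \<inter> \<Phi> -` fst d = fst p \<inter> \<Phi> -` fst d"
      using p(3) by auto
    moreover have "snd c ` (fst c \<inter> fst d) = snd p ` (fst p \<inter> \<Phi> -` fst d)"
      using snd_c by (force simp: c_def)
    ultimately have *: "smooth_on (snd c ` (fst c \<inter> fst d)) (snd d \<circ> \<Phi> \<circ> chart_inv p)"
      using sm(1) p(1) d unfolding smooth_map_def local_rep_def by metis
    have "open (fst d)"
      using A d by (auto simp: smooth_structure_def is_chart_def)
    then have "open (snd c ` (fst c \<inter> fst d))"
      using open_c by (intro is_chart_open_image[OF chart]) auto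
    then show "smooth_on (snd c ` (fst c \<inter> fst d)) (snd d \<circ> chart_inv c)"
    proof (rule smooth_on_cong[OF _ _ *])
      fix y assume "y \<in> snd c ` (fst c \<inter> fst d)"
      then have "y \<in> chart_image p" unfolding image[symmetric] by blast
      then show "(snd d \<circ> \<Phi> \<circ> chart_inv p) y = (snd d \<circ> chart_inv c) y"
        by (simp add: inv)
    qed
    have "snd d ` (fst d \<inter> fst c) = snd d ` (fst d \<inter> U \<inter> ?\<Psi> -` fst p)"
      by (simp add: fst_c Int_assoc)
    then show "smooth_on (snd d ` (fst c \<inter> fst d)) (snd c \<circ> chart_inv d)"
      using sm(2) p(1) d unfolding smooth_map_def local_rep_def
      by (simp add: c_def Int_commute comp_assoc)
  qed
  then show "c \<in> A"
    using A chart unfolding smooth_structure_def by blast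
qed

theorem proposition1p6:
  fixes AM :: "('m::{t2_space,second_countable_topology}, real \<times> 'e::euclidean_space) chart set"
    and AP :: "('p::{t2_space,second_countable_topology}, 'e) chart set"
    and g :: "('m, real \<times> 'e) chart \<Rightarrow> (real \<times> 'e) local_metric"
    and h :: "real \<Rightarrow> ('p, 'e) chart \<Rightarrow> 'e local_metric"
    and \<Phi> :: "real \<times> 'p \<Rightarrow> 'm"
    and u :: "'m \<Rightarrow> real"
    and I :: "real set"
    and f H S :: "real \<Rightarrow> real"
  assumes "smooth_structure AM" and "smooth_structure AP"
    and "riemannian_metric AM g"
    and "equidistant_foliation AM g AP I \<Phi> h"
    and scalar_curvature: "\<And>t c x. \<lbrakk>t \<in> I; c \<in> AP; x \<in> chart_image c\<rbrakk> \<Longrightarrow>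
          endo_trace (ricci_endo (h t c) x) = S t"
    and mean_curvature: "\<And>t c x. \<lbrakk>t \<in> I; c \<in> AP; x \<in> chart_image c\<rbrakk> \<Longrightarrow>
          endo_trace (shape_op (\<lambda>s. h s c) t x) = H t"
    and "\<And>t c x. \<lbrakk>t \<in> I; c \<in> AP; x \<in> chart_image c\<rbrakk> \<Longrightarrow>
          codifferential (h t c) (shape_op (\<lambda>s. h s c) t) x = 0"
    and "\<And>t p. t \<in> I \<Longrightarrow> u (\<Phi> (t, p)) = f t"
    and "steady_gradient_soliton AM g u"
  shows "\<forall>J. is_interval J \<and> J \<subseteq> {t \<in> I. deriv f t \<noteq> H t} \<longrightarrow>
           mono_on J (\<lambda>t. (deriv f t - H t) powi (-2)) \<or>
           antimono_on J (\<lambda>t. (deriv f t - H t) powi (-2))"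
proof -
  note AM = \<open>smooth_structure AM\<close> and AP = \<open>smooth_structure AP\<close>
    and foliation = \<open>equidistant_foliation AM g AP I \<Phi> h\<close>
  have "open I" "is_interval I" and h_metric: "\<And>t. t \<in> I \<Longrightarrow> riemannian_metric AP (h t)"
    using foliation by (auto simp: equidistant_foliation_def)
  obtain U where "open U" and diffeo: "diffeomorphism (product_chart I ` AP) (I \<times> UNIV) AM U \<Phi>"
    using foliation by (auto simp: equidistant_foliation_def)
  \<comment> \<open>A type is never empty and the charts cover it, so there is a chart with a point
    in it.\<close>
  obtain c x where c: "c \<in> AP" and x: "x \<in> chart_image c"
    using AP unfolding smooth_structure_def by (metis UNIV_I UN_E image_eqI)
  have chart_c: "is_chart c"
    using AP c by (auto simp: smooth_structure_def)
  let ?p = "product_chart I c"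
  note p = is_chart_product_chart[OF chart_c \<open>open I\<close>]
  define d where "d = (\<Phi> ` fst ?p, snd ?p \<circ> inv_into (I \<times> UNIV) \<Phi>)"
  have sub: "fst ?p \<subseteq> I \<times> UNIV"
    by (auto simp: product_chart_def)
  note d = pushforward_chart[OF AM diffeo \<open>open U\<close> imageI[OF c] p(1) sub, folded d_def, unfolded p(2)]
  let ?V = "chart_image c"
  have "open ?V"
    using chart_c by (simp add: is_chart_def)
  have inj: "inj_on \<Phi> (I \<times> UNIV)"
    using diffeo by (auto simp: diffeomorphism_def bij_betw_def)
  \<comment> \<open>By the choice of \<open>d\<close>, \<Phi> is the identity in coordinates. Hence
    so is its derivative, and the pullback condition of \<open>equidistant_foliation\<close> becomes
    a formula for \<open>g d\<close> itself.\<close>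
  have F: "local_rep ?p d \<Phi> (t, y) = (t, y)" if "t \<in> I" "y \<in> ?V" for t y
  proof -
    have "inv_into (I \<times> UNIV) \<Phi> (\<Phi> (t, chart_inv c y)) = (t, chart_inv c y)"
      using inj that(1) by simp
    then show ?thesis
      using that by (simp add: local_rep_def d_def p(3)) (simp add: product_chart_def f_inv_into_f)
  qed
  have metric: "g d (t, y) v w = fst v * fst w + h t c y (snd v) (snd w)"
    if t: "t \<in> I" and y: "y \<in> ?V" for t y v w
  proof -
    obtain q where q: "q \<in> fst c" "y = snd c q" using y by auto
    have "frechet_derivative (local_rep ?p d \<Phi>) (at (t, y)) = frechet_derivative (\<lambda>z. z) (at (t, y))"
      by (rule frechet_derivative_cong_open[OF open_Times[OF \<open>open I\<close> \<open>open ?V\<close>]])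
        (use t y F in auto)
    moreover have "\<Phi> (t, q) \<in> fst d"
      using t q by (auto simp: d_def product_chart_def)
    ultimately show ?thesis
      using foliation c d(1) t q(1) unfolding equidistant_foliation_def Let_def
      by (metis F frechet_derivative_ident q(2) y)
  qed
  interpret product_metric I ?V "g d" "\<lambda>t. h t c"
  proof
    show "inner_form (h t c y)" if "t \<in> I" "y \<in> ?V" for t y
      using h_metric[OF that(1)] c that(2) by (auto simp: riemannian_metric_def inner_form_def)
    show "smooth_on (I \<times> ?V) (\<lambda>y. g d y v w)" for v w
      using \<open>riemannian_metric AM g\<close> d(1,2) unfolding riemannian_metric_def by metis
  qed (use \<open>open I\<close> \<open>open ?V\<close> metric in auto)
  have "smooth_fun AM u"
    using \<open>steady_gradient_soliton AM g u\<close> by (simp add: steady_gradient_soliton_def)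
  have soliton: "ricci (g d) (t, x) v w + hessian (g d) (u \<circ> chart_inv d) (t, x) v w = 0"
    if "t \<in> I" for t v w
  proof -
    have "(t, x) \<in> chart_image d"
      using that x by (simp add: d(2))
    then show ?thesis
      using \<open>steady_gradient_soliton AM g u\<close> d(1) unfolding steady_gradient_soliton_def by blast
  qed
  let ?\<phi> = "\<lambda>t. deriv f t - H t"
  have deriv_\<phi>: "\<exists>D\<ge>0. (?\<phi> has_real_derivative D) (at t)" if t: "t \<in> I" for t
  proof (rule soliton_has_derivative[OF t x])
    show "smooth_on (I \<times> ?V) (u \<circ> chart_inv d)"
      using \<open>smooth_fun AM u\<close> d(1) unfolding d(2)[symmetric] smooth_fun_def by blast
    show "(u \<circ> chart_inv d) (s, x) = f s" if "s \<in> I" for s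
      using that x d(3)[of "(s, x)"] p(3)[of s x] \<open>\<And>t p. t \<in> I \<Longrightarrow> u (\<Phi> (t, p)) = f t\<close> by simp
    show "endo_trace (shape_op (\<lambda>t. h t c) s x) = H s" if "s \<in> I" for s
      using mean_curvature[OF that c x] .
  qed (use soliton[OF t] in auto)
  have "mono_on I ?\<phi>"
  proof (rule mono_onI)
    fix r s assume rs: "r \<in> I" "s \<in> I" "r \<le> s"
    then have "\<And>t. r \<le> t \<Longrightarrow> t \<le> s \<Longrightarrow> t \<in> I"
      using \<open>is_interval I\<close> by (meson mem_is_interval_1_I)
    then show "?\<phi> r \<le> ?\<phi> s"
      using deriv_\<phi> by (intro DERIV_nonneg_imp_nondecreasing[OF rs(3)]) blast
  qed
  moreover have "continuous_on I ?\<phi>"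
    using deriv_\<phi> by (metis DERIV_isCont continuous_at_imp_continuous_on)
  ultimately show ?thesis
    by (intro allI impI powi_minus2_monotone) (auto intro: mono_on_subset continuous_on_subset)
qed

end
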